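(* Let $V$ be a finite non-empty set, let $(\Omega,\pi)$ be a probability space, and let $f\in L^2(\Omega^{V},\pi^{\otimes V})$ be real-valued with $\mathrm{Var}(f)>0$. Suppose that there is a subgroup $\Gamma\leq \mathrm{Sym}_V$ acting transitively on $V$ such that $f$ is invariant under the action of $\Gamma$ on $\Omega^V$ by permutation of coordinates. Then for every $U\subseteq V$, $$\mathrm{clue}(f\mid U)\leq \frac{|U|}{|V|}.$$ In particular, sparse reconstruction for transitive functions of iid variables is not possible: if, for each $n$, $f_n\in L^2(\Omega_n^{V_n},\pi_n^{\otimes V_n})$ with $\mathrm{Var}(f_n)>0$ is invariant under some transitive permutation group of the finite set $V_n$, then there is no sequence $U_n\subseteq V_n$ with $\lim_n |U_n|/|V_n|=0$ and $\liminf_n \mathrm{clue}(f_n\mid U_n)>0$.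
   Context: For $U\subseteq V$, $\mathcal F_U$ denotes the $\sigma$-algebra on $\Omega^V$ generated by the coordinates in $U$. For $f\in L^2$ with $\mathrm{Var}(f)>0$, the ($L^2$-)clue is $$\mathrm{clue}(f\mid U):=\frac{\mathrm{Var}(\mathbb E[f\mid\mathcal F_U])}{\mathrm{Var}(f)}.$$ Sparse reconstruction for a sequence of functions $f_n$ on $\Omega_n^{V_n}$ means that there are $U_n\subseteq V_n$ with $|U_n|/|V_n|\to 0$ and $\liminf_n\mathrm{clue}(f_n\mid U_n)>0$. *)

theory Defs
  imports "HOL-Probability.Probability" "HOL-Algebra.Group_Action"
begin

abbreviation iid_space :: "'v set \<Rightarrow> 'a measure \<Rightarrow> ('v \<Rightarrow> 'a) measure" where
  "iid_space V M \<equiv> PiM V (\<lambda>_. M)"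

definition square_integrable :: "'a measure \<Rightarrow> ('a \<Rightarrow> real) \<Rightarrow> bool" where
  "square_integrable M f \<longleftrightarrow> f \<in> borel_measurable M \<and> integrable M (\<lambda>x. (f x)\<^sup>2)"

text \<open>The measure component of \<open>coord_algebra V M U\<close> is irrelevant: it only serves as
  the sub-\<open>\<sigma>\<close>-algebra argument of \<^const>\<open>real_cond_exp\<close>. For \<open>U = {}\<close> it is the trivial
  \<open>\<sigma>\<close>-algebra on the full product space.\<close>

definition coord_algebra :: "'v set \<Rightarrow> 'a measure \<Rightarrow> 'v set \<Rightarrow> ('v \<Rightarrow> 'a) measure" where
  "coord_algebra V M U =
     sigma (space (iid_space V M))
       {(\<lambda>x. x u) -` A \<inter> space (iid_space V M) | u A. u \<in> U \<and> A \<in> sets M}"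

definition clue :: "'v set \<Rightarrow> 'a measure \<Rightarrow> (('v \<Rightarrow> 'a) \<Rightarrow> real) \<Rightarrow> 'v set \<Rightarrow> real" where
  "clue V M f U =
     prob_space.variance (iid_space V M) (real_cond_exp (iid_space V M) (coord_algebra V M U) f)
     / prob_space.variance (iid_space V M) f"

definition transitive_perm_group :: "'v set \<Rightarrow> ('v \<Rightarrow> 'v) set \<Rightarrow> bool" where
  "transitive_perm_group V \<Gamma> \<longleftrightarrow>
     subgroup \<Gamma> (BijGroup V) \<and>
     transitive_action ((BijGroup V)\<lparr>carrier := \<Gamma>\<rparr>) V (\<lambda>\<gamma>. \<gamma>)"

text \<open>The left action \<open>(\<gamma> x)\<^sub>v = x\<^bsub>\<gamma>\<inverse> v\<^esub>\<close> on configurations.\<close>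

definition permute_coords :: "'v set \<Rightarrow> ('v \<Rightarrow> 'v) \<Rightarrow> ('v \<Rightarrow> 'a) \<Rightarrow> ('v \<Rightarrow> 'a)" where
  "permute_coords V \<gamma> x = (\<lambda>v\<in>V. x (inv_into V \<gamma> v))"

text \<open>Elements of \<open>L\<^sup>2\<close> are functions up to null sets, hence invariance holds almost everywhere.\<close>

definition perm_invariant ::
    "'v set \<Rightarrow> 'a measure \<Rightarrow> ('v \<Rightarrow> 'v) set \<Rightarrow> (('v \<Rightarrow> 'a) \<Rightarrow> real) \<Rightarrow> bool" where
  "perm_invariant V M \<Gamma> f \<longleftrightarrow>
     (\<forall>\<gamma>\<in>\<Gamma>. AE x in iid_space V M. f (permute_coords V \<gamma> x) = f x)"

definition sparse_reconstruction ::
    "(nat \<Rightarrow> 'v set) \<Rightarrow> (nat \<Rightarrow> 'a measure) \<Rightarrow> (nat \<Rightarrow> ('v \<Rightarrow> 'a) \<Rightarrow> real) \<Rightarrow> bool" where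
  "sparse_reconstruction V M f \<longleftrightarrow>
     (\<exists>U. (\<forall>n. U n \<subseteq> V n) \<and>
          (\<lambda>n. real (card (U n)) / real (card (V n))) \<longlonglongrightarrow> 0 \<and>
          liminf (\<lambda>n. ereal (clue (V n) (M n) (f n) (U n))) > 0)"

end

theory Submission
  imports Defs
begin

text \<open>Write \<open>E\<^sub>A\<close> for conditioning on the coordinates in \<open>A\<close> and \<open>v A\<close> for the variance of \<open>E\<^sub>A f\<close>.
  Independence gives \<open>E\<^sub>A E\<^sub>B = E\<^bsub>A \<inter> B\<^esub>\<close>, so the \<open>L\<^sup>2\<close>-contraction \<open>E\<^sub>A\<close> maps the increment
  \<open>E\<^bsub>A \<union> B\<^esub> f - E\<^sub>B f\<close> to \<open>E\<^sub>A f - E\<^bsub>A \<inter> B\<^esub> f\<close>. Comparing norms,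
  \<open>v A - v (A \<inter> B) \<le> v (A \<union> B) - v B\<close>: the set function \<open>v\<close> is supermodular. Revealing the
  coordinates one by one, a family \<open>S\<^sub>j\<close> that covers every coordinate at most \<open>c\<close> times therefore
  satisfies \<open>\<Sum>\<^sub>j v S\<^sub>j \<le> c * v V\<close>. For the translates \<open>\<gamma> U\<close>, all summands agree by
  invariance of \<open>f\<close>, and transitivity gives \<open>c = |\<Gamma>| |U| / |V|\<close>.\<close>

section \<open>Square-integrable functions and conditional expectation\<close>

lemma integrable_mult_if_square_integrable:
  assumes "square_integrable M f" "square_integrable M g"
  shows "integrable M (\<lambda>x. f x * g x)"
proof (rule Bochner_Integration.integrable_bound)
  show "integrable M (\<lambda>x. (f x)\<^sup>2 + (g x)\<^sup>2)"
    using assms by (simp add: square_integrable_def)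
  have "\<bar>a * b\<bar> \<le> a\<^sup>2 + b\<^sup>2" for a b :: real
  proof -
    have "2 * \<bar>a * b\<bar> \<le> a\<^sup>2 + b\<^sup>2"
      using sum_squares_bound[of "\<bar>a\<bar>" "\<bar>b\<bar>"] by (simp add: abs_mult mult.assoc)
    then show ?thesis
      using abs_ge_zero[of "a * b"] by linarith
  qed
  then show "AE x in M. norm (f x * g x) \<le> norm ((f x)\<^sup>2 + (g x)\<^sup>2)"
    by simp
qed (use assms in \<open>auto simp: square_integrable_def\<close>)

lemma square_integrable_diff:
  assumes "square_integrable M f" "square_integrable M g"
  shows "square_integrable M (\<lambda>x. f x - g x)"
  using assms integrable_mult_if_square_integrable[OF assms]
  by (auto simp: square_integrable_def power2_diff mult.assoc)

lemma (in finite_measure) integrable_if_square_integrable: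
  "square_integrable M f \<Longrightarrow> integrable M f"
  by (auto simp: square_integrable_def intro: square_integrable_imp_integrable)

context finite_measure_subalgebra
begin

lemma square_integrable_real_cond_exp:
  assumes "square_integrable M f"
  shows "square_integrable M (real_cond_exp M F f)"
  using integrable_convex_cond_exp[of f UNIV _ _ power2] integrable_if_square_integrable[OF assms]
    assms convex_power2
  by (simp add: square_integrable_def)

lemma real_cond_exp_pythagoras:
  assumes f: "square_integrable M f"
  shows "(\<integral>x. (f x)\<^sup>2 \<partial>M)
    = (\<integral>x. (real_cond_exp M F f x)\<^sup>2 \<partial>M) + (\<integral>x. (f x - real_cond_exp M F f x)\<^sup>2 \<partial>M)"
proof -
  let ?g = "real_cond_exp M F f"
  have g: "square_integrable M ?g"
    by (rule square_integrable_real_cond_exp[OF f])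
  have gf: "integrable M (\<lambda>x. ?g x * f x)"
    by (rule integrable_mult_if_square_integrable[OF g f])
  have "(\<integral>x. ?g x * f x \<partial>M) = (\<integral>x. ?g x * ?g x \<partial>M)"
    using gf f by (intro real_cond_exp_intg(2)[symmetric]) (auto simp: square_integrable_def)
  moreover have "(\<integral>x. (f x - ?g x)\<^sup>2 \<partial>M) = (\<integral>x. (f x)\<^sup>2 + (?g x)\<^sup>2 - 2 * (?g x * f x) \<partial>M)"
    by (simp add: power2_diff mult_ac)
  moreover have "\<dots> = (\<integral>x. (f x)\<^sup>2 \<partial>M) + (\<integral>x. (?g x)\<^sup>2 \<partial>M) - 2 * (\<integral>x. ?g x * f x \<partial>M)"
    using f g gf by (simp add: square_integrable_def)
  ultimately show ?thesis
    by (simp add: power2_eq_square)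
qed

lemma integral_real_cond_exp_square_le:
  assumes "square_integrable M f"
  shows "(\<integral>x. (real_cond_exp M F f x)\<^sup>2 \<partial>M) \<le> (\<integral>x. (f x)\<^sup>2 \<partial>M)"
  by (simp add: real_cond_exp_pythagoras[OF assms])

end

lemma (in finite_measure) finite_measure_subalgebraI:
  "subalgebra M F \<Longrightarrow> finite_measure_subalgebra M F"
  by unfold_locales

lemma measurable_into_subalgebra:
  "subalgebra N G \<Longrightarrow> T \<in> measurable M N \<Longrightarrow> T \<in> measurable M G"
  by (auto simp: subalgebra_def measurable_def)

lemma subalgebra_vimage_algebra:
  "T \<in> measurable M N \<Longrightarrow> subalgebra M (vimage_algebra (space M) T N)"
  by (simp add: subalgebra_def sets_image_in_sets)

definition explained_variance :: "'a measure \<Rightarrow> 'a measure \<Rightarrow> ('a \<Rightarrow> real) \<Rightarrow> real" where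
  "explained_variance M F f = prob_space.variance M (real_cond_exp M F f)"

context prob_space
begin

lemma law_of_total_variance:
  assumes F: "subalgebra M F" and f: "square_integrable M f"
  shows "variance f = explained_variance M F f + expectation (\<lambda>x. (f x - real_cond_exp M F f x)\<^sup>2)"
proof -
  interpret finite_measure_subalgebra M F
    by (rule finite_measure_subalgebraI[OF F])
  have eq: "variance g = expectation (\<lambda>x. (g x)\<^sup>2) - (expectation g)\<^sup>2"
    if "square_integrable M g" for g
    using that integrable_if_square_integrable[OF that]
    by (intro variance_eq) (auto simp: square_integrable_def)
  have "expectation (real_cond_exp M F f) = expectation f"
    by (rule real_cond_exp_int(2)[OF integrable_if_square_integrable[OF f]])
  then show ?thesis
    unfolding explained_variance_def eq[OF f] eq[OF square_integrable_real_cond_exp[OF f]]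
    using real_cond_exp_pythagoras[OF f] by simp
qed

lemma variance_cong_AE:
  fixes f g :: "'a \<Rightarrow> real"
  assumes eq: "AE x in M. f x = g x"
    and [measurable]: "f \<in> borel_measurable M" "g \<in> borel_measurable M"
  shows "variance f = variance g"
proof -
  have mean: "expectation f = expectation g"
    using eq by (intro integral_cong_AE) auto
  show ?thesis
    unfolding mean using eq by (intro integral_cong_AE) auto
qed

lemma explained_variance_cong_AE:
  assumes "subalgebra M F" "AE x in M. f x = g x" "f \<in> borel_measurable M" "g \<in> borel_measurable M"
  shows "explained_variance M F f = explained_variance M F g"
proof -
  interpret finite_measure_subalgebra M F
    by (rule finite_measure_subalgebraI[OF assms(1)])
  show ?thesis
    unfolding explained_variance_def by (intro variance_cong_AE real_cond_exp_cong assms) simp_all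
qed

lemma explained_variance_increment:
  assumes F: "subalgebra M F" and G: "subalgebra M G" and FG: "subalgebra G F"
    and f: "square_integrable M f"
  shows "explained_variance M G f - explained_variance M F f
    = expectation (\<lambda>x. (real_cond_exp M G f x - real_cond_exp M F f x)\<^sup>2)"
proof -
  interpret F: finite_measure_subalgebra M F
    by (rule finite_measure_subalgebraI[OF F])
  interpret G: finite_measure_subalgebra M G
    by (rule finite_measure_subalgebraI[OF G])
  let ?g = "real_cond_exp M G f"
  have g: "square_integrable M ?g"
    by (rule G.square_integrable_real_cond_exp[OF f])
  have tower: "AE x in M. real_cond_exp M F ?g x = real_cond_exp M F f x"
    by (rule F.real_cond_exp_nested_subalg[OF G FG integrable_if_square_integrable[OF f]])
  have "explained_variance M G f
      = explained_variance M F ?g + expectation (\<lambda>x. (?g x - real_cond_exp M F ?g x)\<^sup>2)"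
    unfolding explained_variance_def[of M G] by (rule law_of_total_variance[OF F g])
  moreover have "explained_variance M F ?g = explained_variance M F f"
    unfolding explained_variance_def using tower by (intro variance_cong_AE) auto
  moreover have "expectation (\<lambda>x. (?g x - real_cond_exp M F ?g x)\<^sup>2)
      = expectation (\<lambda>x. (?g x - real_cond_exp M F f x)\<^sup>2)"
    using tower by (intro integral_cong_AE) auto
  ultimately show ?thesis
    by simp
qed

lemma real_cond_exp_vimage_algebra:
  assumes T: "T \<in> measurable M N" and distr: "distr M N T = N"
    and G: "subalgebra N G" and f: "integrable N f"
  shows "AE x in M. real_cond_exp M (vimage_algebra (space M) T G) (\<lambda>x. f (T x)) x
    = real_cond_exp N G f (T x)"
proof -
  interpret N: prob_space N
    using prob_space_distr[OF T] unfolding distr .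
  interpret N: finite_measure_subalgebra N G
    by (rule N.finite_measure_subalgebraI[OF G])
  have TG: "T \<in> measurable M G"
    by (rule measurable_into_subalgebra[OF G T])
  then have T_space: "T \<in> space M \<rightarrow> space G"
    by (auto dest: measurable_space)
  interpret finite_measure_subalgebra M "vimage_algebra (space M) T G"
    by (rule finite_measure_subalgebraI[OF subalgebra_vimage_algebra[OF TG]])
  let ?g = "real_cond_exp N G f"
  show ?thesis
  proof (rule real_cond_exp_charact)
    show "integrable M (\<lambda>x. f (T x))" "integrable M (\<lambda>x. ?g (T x))"
      using f N.real_cond_exp_int(1)[OF f] by (auto intro!: integrable_distr[OF T] simp: distr)
    show "(\<lambda>x. ?g (T x)) \<in> borel_measurable (vimage_algebra (space M) T G)"
      by (intro measurable_compose[OF measurable_vimage_algebra1[OF T_space]]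
          borel_measurable_cond_exp)
    fix C assume "C \<in> sets (vimage_algebra (space M) T G)"
    then obtain D where D: "D \<in> sets G" "C = T -` D \<inter> space M"
      by (auto simp: sets_vimage_algebra2[OF T_space])
    have [measurable]: "D \<in> sets N"
      using D(1) G by (auto simp: subalgebra_def)
    have pullback: "(\<integral>x\<in>C. h (T x) \<partial>M) = (\<integral>y\<in>D. h y \<partial>N)"
      if [measurable]: "h \<in> borel_measurable N" for h :: "_ \<Rightarrow> real"
    proof -
      have "(\<integral>x\<in>C. h (T x) \<partial>M) = (\<integral>x. indicator D (T x) * h (T x) \<partial>M)"
        unfolding set_lebesgue_integral_def D(2)
        by (intro Bochner_Integration.integral_cong) (auto simp: indicator_def)
      also have "\<dots> = (\<integral>y. indicator D y * h y \<partial>distr M N T)"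
        by (intro integral_distr[symmetric] T) simp
      finally show ?thesis
        by (simp add: set_lebesgue_integral_def distr)
    qed
    show "(\<integral>x\<in>C. f (T x) \<partial>M) = (\<integral>x\<in>C. ?g (T x) \<partial>M)"
      using f N.real_cond_exp_intA[OF f D(1)] by (simp add: pullback)
  qed
qed

lemma explained_variance_vimage_algebra:
  assumes T: "T \<in> measurable M N" and distr: "distr M N T = N"
    and G: "subalgebra N G" and f: "integrable N f"
  shows "explained_variance M (vimage_algebra (space M) T G) (\<lambda>x. f (T x))
    = explained_variance N G f"
proof -
  let ?g = "real_cond_exp N G f"
  have [measurable]: "?g \<in> borel_measurable N"
    by (rule borel_measurable_cond_exp2)
  note [measurable] = T
  have "explained_variance M (vimage_algebra (space M) T G) (\<lambda>x. f (T x)) = variance (\<lambda>x. ?g (T x))"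
    unfolding explained_variance_def
    by (intro variance_cong_AE real_cond_exp_vimage_algebra assms) simp_all
  also have "\<dots> = integral\<^sup>L (distr M N T) (\<lambda>y. (?g y - integral\<^sup>L (distr M N T) ?g)\<^sup>2)"
    by (simp add: integral_distr)
  finally show ?thesis
    by (simp add: explained_variance_def distr)
qed

end

section \<open>Supermodular set functions\<close>

definition supermodular_on :: "'a set \<Rightarrow> ('a set \<Rightarrow> 'b::linordered_idom) \<Rightarrow> bool" where
  "supermodular_on V h \<longleftrightarrow> (\<forall>A\<subseteq>V. \<forall>B\<subseteq>V. h A + h B \<le> h (A \<union> B) + h (A \<inter> B))"

lemma supermodular_onD:
  "supermodular_on V h \<Longrightarrow> A \<subseteq> V \<Longrightarrow> B \<subseteq> V \<Longrightarrow> h A + h B \<le> h (A \<union> B) + h (A \<inter> B)"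
  by (auto simp: supermodular_on_def)

lemma sum_supermodular_le:
  fixes h :: "'a set \<Rightarrow> 'b::linordered_idom"
  assumes "finite V" "finite I" and super: "supermodular_on V h" and mono: "mono_on (Pow V) h"
    and empty: "h {} = 0"
    and S: "\<And>i. i \<in> I \<Longrightarrow> S i \<subseteq> V"
    and cover: "\<And>v. v \<in> V \<Longrightarrow> of_nat (card {i \<in> I. v \<in> S i}) \<le> c"
  shows "(\<Sum>i\<in>I. h (S i)) \<le> c * h V"
proof -
  have "(\<Sum>i\<in>I. h (S i \<inter> W)) \<le> c * h W" if "W \<subseteq> V" for W
    using finite_subset[OF that \<open>finite V\<close>] that
  proof (induction W)
    case (insert v W)
    define \<Delta> where "\<Delta> = h (insert v W) - h W"
    have \<Delta>: "0 \<le> \<Delta>"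
      using mono_onD[OF mono, of W "insert v W"] insert.prems by (auto simp: \<Delta>_def)
    have "h (S i \<inter> insert v W) \<le> h (S i \<inter> W) + (if v \<in> S i then \<Delta> else 0)" if "i \<in> I" for i
    proof (cases "v \<in> S i")
      case True
      then have "S i \<inter> insert v W \<union> W = insert v W" "S i \<inter> insert v W \<inter> W = S i \<inter> W"
        by auto
      then show ?thesis
        using supermodular_onD[OF super, of "S i \<inter> insert v W" W] S[OF that] insert.prems True
        by (auto simp: \<Delta>_def algebra_simps)
    qed simp
    then have "(\<Sum>i\<in>I. h (S i \<inter> insert v W)) \<le> (\<Sum>i\<in>I. h (S i \<inter> W) + (if v \<in> S i then \<Delta> else 0))"
      by (rule sum_mono)
    also have "\<dots> = (\<Sum>i\<in>I. h (S i \<inter> W)) + of_nat (card {i \<in> I. v \<in> S i}) * \<Delta>"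
      using \<open>finite I\<close> by (simp add: sum.distrib sum.If_cases Int_def)
    also have "\<dots> \<le> c * h W + c * \<Delta>"
      using insert cover[of v] \<Delta> by (intro add_mono mult_right_mono) auto
    finally show ?case
      by (simp add: \<Delta>_def algebra_simps)
  qed (simp add: empty)
  from this[OF order_refl] show ?thesis
    using S by (simp add: Int_absorb2)
qed

section \<open>Translates under a transitive action\<close>

lemma finite_Bij: "finite V \<Longrightarrow> finite (Bij V)"
  by (rule finite_subset[OF _ finite_PiE[of V "\<lambda>_. V"]]) (auto simp: Bij_def PiE_def bij_betw_def)

context transitive_action
begin

lemma card_translates_containing_le:
  assumes "finite (carrier G)" "U \<subseteq> E" "x \<in> E" "y \<in> E"
  shows "card {g \<in> carrier G. x \<in> \<phi> g ` U} \<le> card {g \<in> carrier G. y \<in> \<phi> g ` U}"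
proof -
  interpret group G
    using group_hom by (rule group_hom.axioms)
  obtain h where h: "h \<in> carrier G" "\<phi> h x = y"
    using unique_orbit[OF \<open>x \<in> E\<close> \<open>y \<in> E\<close>] by blast
  have "\<phi> (h \<otimes> g) ` U = \<phi> h ` \<phi> g ` U" if "g \<in> carrier G" for g
    using composition_rule[OF _ h(1) that] \<open>U \<subseteq> E\<close> by (force simp: image_image intro!: image_cong)
  then have "(\<lambda>g. h \<otimes> g) ` {g \<in> carrier G. x \<in> \<phi> g ` U} \<subseteq> {g \<in> carrier G. y \<in> \<phi> g ` U}"
    using h by auto
  moreover have "inj_on (\<lambda>g. h \<otimes> g) {g \<in> carrier G. x \<in> \<phi> g ` U}"
    using h by (auto intro: inj_onI)
  ultimately show ?thesis
    using \<open>finite (carrier G)\<close> by (intro card_inj_on_le) auto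
qed

lemma card_translates_containing:
  assumes "finite (carrier G)" "finite E" "U \<subseteq> E" "x \<in> E"
  shows "card E * card {g \<in> carrier G. x \<in> \<phi> g ` U} = order G * card U"
proof -
  have card_translate: "card {y \<in> E. y \<in> \<phi> g ` U} = card U" if "g \<in> carrier G" for g
  proof -
    have "{y \<in> E. y \<in> \<phi> g ` U} = \<phi> g ` U"
      using element_image[OF that] \<open>U \<subseteq> E\<close> by blast
    then show ?thesis
      using inj_on_subset[OF inj_prop[OF that] \<open>U \<subseteq> E\<close>] by (simp add: card_image)
  qed
  have "order G * card U = (\<Sum>g\<in>carrier G. card {y \<in> E. y \<in> \<phi> g ` U})"
    by (simp add: card_translate order_def)
  also have "\<dots> = card {g \<in> carrier G. x \<in> \<phi> g ` U} * card E"
    using assms by (intro sum_multicount ballI antisym card_translates_containing_le)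
  finally show ?thesis
    by simp
qed

end

section \<open>Conditioning on coordinates of a product space\<close>

definition cylinder_algebra :: "'i set \<Rightarrow> ('i \<Rightarrow> 'a measure) \<Rightarrow> 'i set \<Rightarrow> ('i \<Rightarrow> 'a) measure" where
  "cylinder_algebra I M A = vimage_algebra (space (PiM I M)) (\<lambda>x. restrict x A) (PiM A M)"

lemma space_cylinder_algebra [simp]: "space (cylinder_algebra I M A) = space (PiM I M)"
  by (simp add: cylinder_algebra_def)

lemma
  assumes "A \<subseteq> I"
  shows sets_cylinder_algebra:
      "sets (cylinder_algebra I M A)
        = {(\<lambda>x. restrict x A) -` D \<inter> space (PiM I M) | D. D \<in> sets (PiM A M)}"
    and measurable_cylinder_algebra_restrict:
      "(\<lambda>x. restrict x A) \<in> measurable (cylinder_algebra I M A) (PiM A M)"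
proof -
  have "(\<lambda>x. restrict x A) \<in> space (PiM I M) \<rightarrow> space (PiM A M)"
    using assms by (auto simp: space_PiM)
  then show "sets (cylinder_algebra I M A)
      = {(\<lambda>x. restrict x A) -` D \<inter> space (PiM I M) | D. D \<in> sets (PiM A M)}"
    and "(\<lambda>x. restrict x A) \<in> measurable (cylinder_algebra I M A) (PiM A M)"
    unfolding cylinder_algebra_def by (rule sets_vimage_algebra2, rule measurable_vimage_algebra1)
qed

lemma subalgebra_cylinder_algebra:
  "A \<subseteq> I \<Longrightarrow> subalgebra (PiM I M) (cylinder_algebra I M A)"
  unfolding cylinder_algebra_def by (intro subalgebra_vimage_algebra measurable_restrict_subset)

lemma subalgebra_cylinder_algebra_mono:
  assumes "A \<subseteq> B" "B \<subseteq> I"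
  shows "subalgebra (cylinder_algebra I M B) (cylinder_algebra I M A)"
proof -
  have "(\<lambda>x. restrict (restrict x B) A) \<in> measurable (cylinder_algebra I M B) (PiM A M)"
    by (rule measurable_compose[OF measurable_cylinder_algebra_restrict[OF \<open>B \<subseteq> I\<close>]
          measurable_restrict_subset[OF \<open>A \<subseteq> B\<close>]])
  then have "(\<lambda>x. restrict x A) \<in> measurable (cylinder_algebra I M B) (PiM A M)"
    using \<open>A \<subseteq> B\<close> by (simp add: Int_absorb1)
  from subalgebra_vimage_algebra[OF this] show ?thesis
    by (simp add: cylinder_algebra_def[of I M A])
qed

lemma borel_measurable_cylinder_algebraD:
  fixes h :: "('i \<Rightarrow> 'a) \<Rightarrow> real"
  assumes A: "A \<subseteq> I" and h: "h \<in> borel_measurable (cylinder_algebra I M A)"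
    and xy: "x \<in> space (PiM I M)" "y \<in> space (PiM I M)" "restrict x A = restrict y A"
  shows "h x = h y"
proof -
  have "h -` {h y} \<inter> space (cylinder_algebra I M A) \<in> sets (cylinder_algebra I M A)"
    by (intro measurable_sets[OF h]) simp
  then obtain D where "h -` {h y} \<inter> space (PiM I M) = (\<lambda>x. restrict x A) -` D \<inter> space (PiM I M)"
    by (auto simp: sets_cylinder_algebra[OF A])
  then have "x \<in> h -` {h y} \<longleftrightarrow> y \<in> h -` {h y}"
    using xy by (metis (no_types, lifting) IntD1 IntI vimage_eq)
  then show ?thesis
    by simp
qed

context finite_product_prob_space
begin

abbreviation coord_exp :: "'a set \<Rightarrow> (('a \<Rightarrow> 'b) \<Rightarrow> real) \<Rightarrow> ('a \<Rightarrow> 'b) \<Rightarrow> real" where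
  "coord_exp A \<equiv> real_cond_exp (PiM I M) (cylinder_algebra I M A)"

abbreviation coord_variance :: "(('a \<Rightarrow> 'b) \<Rightarrow> real) \<Rightarrow> 'a set \<Rightarrow> real" where
  "coord_variance f A \<equiv> explained_variance (PiM I M) (cylinder_algebra I M A) f"

lemma finite_measure_subalgebra_cylinder_algebra:
  "A \<subseteq> I \<Longrightarrow> finite_measure_subalgebra (PiM I M) (cylinder_algebra I M A)"
  by (intro P.finite_measure_subalgebraI subalgebra_cylinder_algebra)

lemma borel_measurable_cylinder_algebraI:
  fixes h :: "('a \<Rightarrow> 'b) \<Rightarrow> real"
  assumes A: "A \<subseteq> I" and h: "h \<in> borel_measurable (PiM I M)"
    and determined: "\<And>x y. x \<in> space (PiM I M) \<Longrightarrow> y \<in> space (PiM I M) \<Longrightarrow>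
      restrict x A = restrict y A \<Longrightarrow> h x = h y"
  shows "h \<in> borel_measurable (cylinder_algebra I M A)"
proof -
  interpret rest: finite_product_prob_space M "I - A"
    by unfold_locales (simp add: finite_index)
  obtain w where w: "w \<in> space (PiM (I - A) M)"
    using rest.P.not_empty by blast
  let ?fill = "\<lambda>z. merge A (I - A) (z, w)"
  have AI: "A \<union> (I - A) = I"
    using A by blast
  have fill: "?fill \<in> measurable (PiM A M) (PiM I M)"
    using measurable_compose[OF measurable_Pair2'[OF w, of "PiM A M"] measurable_merge]
    unfolding AI .
  have eq: "h x = h (?fill (restrict x A))" if "x \<in> space (cylinder_algebra I M A)" for x
  proof (rule determined[OF _ measurable_space[OF fill]])
    show "restrict x A \<in> space (PiM A M)"
      using that A by (auto simp: space_PiM)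
  qed (use that in simp_all)
  have "(\<lambda>x. h (?fill (restrict x A))) \<in> borel_measurable (cylinder_algebra I M A)"
    by (intro measurable_compose[OF measurable_cylinder_algebra_restrict[OF A]]
        measurable_compose[OF fill h])
  then show ?thesis
    by (simp only: measurable_cong[of "cylinder_algebra I M A" h, OF eq])
qed

definition average_off :: "'a set \<Rightarrow> (('a \<Rightarrow> 'b) \<Rightarrow> real) \<Rightarrow> ('a \<Rightarrow> 'b) \<Rightarrow> real" where
  "average_off A f x = (\<integral>y. f (merge A (I - A) (x, y)) \<partial>PiM (I - A) M)"

lemma average_off_restrict [simp]: "average_off A f (restrict x A) = average_off A f x"
  by (simp add: average_off_def)

lemma
  assumes A: "A \<subseteq> I" and f: "integrable (PiM I M) f"
  shows integrable_marginal_average_off: "integrable (PiM A M) (average_off A f)"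
    and integral_marginal_average_off: "(\<integral>x. average_off A f x \<partial>PiM A M) = (\<integral>x. f x \<partial>PiM I M)"
proof -
  have fin: "finite A" "finite (I - A)" and AI: "A \<union> (I - A) = I"
    using A finite_index finite_subset by auto
  interpret A: finite_product_prob_space M A
    by unfold_locales (rule fin)
  interpret rest: finite_product_prob_space M "I - A"
    by unfold_locales (rule fin)
  interpret pair_sigma_finite "PiM A M" "PiM (I - A) M" ..
  have "integrable (PiM A M \<Otimes>\<^sub>M PiM (I - A) M) (\<lambda>z. f (merge A (I - A) z))"
    using distr_merge[of A "I - A"] f fin unfolding AI
    by (intro integrable_distr[OF measurable_merge[of A "I - A", unfolded AI]]) simp
  then show "integrable (PiM A M) (average_off A f)"
    unfolding average_off_def[abs_def] by (rule integrable_fst')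
  show "(\<integral>x. average_off A f x \<partial>PiM A M) = (\<integral>x. f x \<partial>PiM I M)"
    unfolding average_off_def using product_integral_fold[of A "I - A" f] fin f unfolding AI by simp
qed

lemma
  assumes A: "A \<subseteq> I" and f: "integrable (PiM I M) f"
  shows integrable_average_off: "integrable (PiM I M) (average_off A f)"
    and borel_measurable_average_off: "average_off A f \<in> borel_measurable (cylinder_algebra I M A)"
proof -
  note avg = integrable_marginal_average_off[OF A f]
  note restrict = measurable_cylinder_algebra_restrict[OF A]
  show "integrable (PiM I M) (average_off A f)"
    using integrable_distr[OF measurable_restrict_subset[OF A], of M "average_off A f"] avg
    by (simp add: distr_restrict[OF A finite_index, symmetric])
  show "average_off A f \<in> borel_measurable (cylinder_algebra I M A)"
    using measurable_compose[OF restrict borel_measurable_integrable[OF avg]] by simp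
qed

lemma coord_exp_eq_average_off:
  assumes A: "A \<subseteq> I" and f: "integrable (PiM I M) f"
  shows "AE x in PiM I M. coord_exp A f x = average_off A f x"
proof -
  interpret finite_measure_subalgebra "PiM I M" "cylinder_algebra I M A"
    by (rule finite_measure_subalgebra_cylinder_algebra[OF A])
  let ?r = "\<lambda>x. restrict x A"
  have r: "?r \<in> measurable (PiM I M) (PiM A M)"
    by (rule measurable_restrict_subset[OF A])
  note [measurable] = r borel_measurable_integrable[OF f]
    borel_measurable_integrable[OF integrable_marginal_average_off[OF A f]]
  show ?thesis
  proof (intro real_cond_exp_charact f integrable_average_off borel_measurable_average_off A)
    fix C assume "C \<in> sets (cylinder_algebra I M A)"
    then obtain D where [measurable]: "D \<in> sets (PiM A M)" and C_eq: "C = ?r -` D \<inter> space (PiM I M)"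
      by (auto simp: sets_cylinder_algebra[OF A])
    have C_ind: "(\<integral>x\<in>C. h x \<partial>PiM I M) = (\<integral>x. indicator D (?r x) * h x \<partial>PiM I M)" for h :: "_ \<Rightarrow> real"
      unfolding set_lebesgue_integral_def C_eq
      by (intro Bochner_Integration.integral_cong) (auto simp: indicator_def)
    have "integrable (PiM I M) (\<lambda>x. indicator D (?r x) * f x)"
      by (rule Bochner_Integration.integrable_bound[OF f]) (auto simp: indicator_def)
    then have "(\<integral>x\<in>C. f x \<partial>PiM I M) = (\<integral>x. average_off A (\<lambda>x. indicator D (?r x) * f x) x \<partial>PiM A M)"
      unfolding C_ind by (rule integral_marginal_average_off[OF A, symmetric])
    also have "\<dots> = (\<integral>x. indicator D (?r x) * average_off A f x \<partial>PiM A M)"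
      by (simp add: average_off_def)
    also have "\<dots> = (\<integral>x. indicator D x * average_off A f x \<partial>PiM A M)"
      by (intro Bochner_Integration.integral_cong) (simp_all add: space_PiM)
    also have "\<dots> = (\<integral>x. indicator D (?r x) * average_off A f x \<partial>PiM I M)"
      using integral_distr[OF r, of "\<lambda>x. indicator D x * average_off A f x"]
      by (simp add: distr_restrict[OF A finite_index, symmetric])
    also have "\<dots> = (\<integral>x\<in>C. average_off A f x \<partial>PiM I M)"
      unfolding C_ind ..
    finally show "(\<integral>x\<in>C. f x \<partial>PiM I M) = (\<integral>x\<in>C. average_off A f x \<partial>PiM I M)" .
  qed
qed

lemma average_off_eq_if_restrict_Int_eq:
  assumes A: "A \<subseteq> I" and B: "B \<subseteq> I" and f: "f \<in> borel_measurable (cylinder_algebra I M B)"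
    and x: "x \<in> space (PiM I M)" and x': "x' \<in> space (PiM I M)"
    and eq: "restrict x (A \<inter> B) = restrict x' (A \<inter> B)"
  shows "average_off A f x = average_off A f x'"
  unfolding average_off_def
proof (rule Bochner_Integration.integral_cong[OF refl])
  fix y assume y: "y \<in> space (PiM (I - A) M)"
  have AI: "A \<union> (I - A) = I"
    using A by blast
  have "merge A (I - A) (z, y) \<in> space (PiM I M)" if "z \<in> space (PiM I M)" for z
    using PiE_cancel_merge[of A "I - A" z y "\<lambda>i. space (M i)"] that y A
    unfolding AI by (auto simp: space_PiM PiE_iff)
  moreover have "restrict (merge A (I - A) (x, y)) B = restrict (merge A (I - A) (x', y)) B"
  proof (rule restrict_ext)
    show "merge A (I - A) (x, y) i = merge A (I - A) (x', y) i" if "i \<in> B" for i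
      using fun_cong[OF eq, of i] that by (cases "i \<in> A") (simp_all add: merge_def)
  qed
  ultimately show "f (merge A (I - A) (x, y)) = f (merge A (I - A) (x', y))"
    using x x' by (intro borel_measurable_cylinder_algebraD[OF B f])
qed

lemma coord_exp_nested:
  assumes "A \<subseteq> B" "B \<subseteq> I" "integrable (PiM I M) f"
  shows "AE x in PiM I M. coord_exp A (coord_exp B f) x = coord_exp A f x"
proof -
  interpret finite_measure_subalgebra "PiM I M" "cylinder_algebra I M A"
    using assms by (intro finite_measure_subalgebra_cylinder_algebra) auto
  show ?thesis
    using assms
    by (intro real_cond_exp_nested_subalg subalgebra_cylinder_algebra
        subalgebra_cylinder_algebra_mono)
qed

lemma coord_exp_of_cylinder_measurable:
  assumes A: "A \<subseteq> I" and B: "B \<subseteq> I"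
    and f: "integrable (PiM I M) f" and f_B: "f \<in> borel_measurable (cylinder_algebra I M B)"
  shows "AE x in PiM I M. coord_exp A f x = coord_exp (A \<inter> B) f x"
proof -
  let ?P = "PiM I M" and ?g = "average_off A f"
  have AB: "A \<inter> B \<subseteq> I"
    using A by auto
  interpret AB: finite_measure_subalgebra ?P "cylinder_algebra I M (A \<inter> B)"
    by (rule finite_measure_subalgebra_cylinder_algebra[OF AB])
  note g = integrable_average_off[OF A f]
  have g_AB: "?g \<in> borel_measurable (cylinder_algebra I M (A \<inter> B))"
    by (intro borel_measurable_cylinder_algebraI AB borel_measurable_integrable g
        average_off_eq_if_restrict_Int_eq[OF A B f_B])
  have average: "AE x in ?P. coord_exp A f x = ?g x"
    by (rule coord_exp_eq_average_off[OF A f])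
  have "AE x in ?P. coord_exp (A \<inter> B) (coord_exp A f) x = coord_exp (A \<inter> B) f x"
    by (rule coord_exp_nested[OF _ A f]) simp
  moreover have "AE x in ?P. coord_exp (A \<inter> B) (coord_exp A f) x = coord_exp (A \<inter> B) ?g x"
    using average g by (intro AB.real_cond_exp_cong) auto
  moreover have "AE x in ?P. coord_exp (A \<inter> B) ?g x = ?g x"
    by (rule AB.real_cond_exp_F_meas[OF g g_AB])
  ultimately show ?thesis
    using average by eventually_elim simp
qed

lemma coord_exp_coord_exp:
  assumes A: "A \<subseteq> I" and B: "B \<subseteq> I" and f: "integrable (PiM I M) f"
  shows "AE x in PiM I M. coord_exp A (coord_exp B f) x = coord_exp (A \<inter> B) f x"
proof -
  interpret B: finite_measure_subalgebra "PiM I M" "cylinder_algebra I M B"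
    by (rule finite_measure_subalgebra_cylinder_algebra[OF B])
  have "AE x in PiM I M. coord_exp A (coord_exp B f) x = coord_exp (A \<inter> B) (coord_exp B f) x"
    by (intro coord_exp_of_cylinder_measurable A B B.real_cond_exp_int f borel_measurable_cond_exp)
  moreover have "AE x in PiM I M. coord_exp (A \<inter> B) (coord_exp B f) x = coord_exp (A \<inter> B) f x"
    by (rule coord_exp_nested[OF _ B f]) simp
  ultimately show ?thesis
    by eventually_elim simp
qed

lemma square_integrable_coord_exp:
  "A \<subseteq> I \<Longrightarrow> square_integrable (PiM I M) f \<Longrightarrow> square_integrable (PiM I M) (coord_exp A f)"
  by (rule finite_measure_subalgebra.square_integrable_real_cond_exp
      [OF finite_measure_subalgebra_cylinder_algebra])

lemma coord_variance_increment:
  assumes "A \<subseteq> B" "B \<subseteq> I" "square_integrable (PiM I M) f"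
  shows "coord_variance f B - coord_variance f A
    = (\<integral>x. (coord_exp B f x - coord_exp A f x)\<^sup>2 \<partial>PiM I M)"
  using assms
  by (intro P.explained_variance_increment subalgebra_cylinder_algebra
      subalgebra_cylinder_algebra_mono) auto

lemma mono_on_coord_variance:
  assumes "square_integrable (PiM I M) f"
  shows "mono_on (Pow I) (coord_variance f)"
proof (rule mono_onI)
  fix A B assume "A \<in> Pow I" "B \<in> Pow I" "A \<subseteq> B"
  then have "0 \<le> coord_variance f B - coord_variance f A"
    using assms by (subst coord_variance_increment) auto
  then show "coord_variance f A \<le> coord_variance f B"
    by simp
qed

lemma supermodular_on_coord_variance:
  assumes f: "square_integrable (PiM I M) f"
  shows "supermodular_on I (coord_variance f)"
  unfolding supermodular_on_def
proof (intro allI impI)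
  fix A B assume A: "A \<subseteq> I" and B: "B \<subseteq> I"
  let ?P = "PiM I M" and ?e = "\<lambda>C. coord_exp C f" and ?v = "coord_variance f"
  let ?d = "\<lambda>x. ?e (A \<union> B) x - ?e B x"
  interpret A: finite_measure_subalgebra ?P "cylinder_algebra I M A"
    by (rule finite_measure_subalgebra_cylinder_algebra[OF A])
  have project: "AE x in ?P. coord_exp A (?e C) x = ?e (A \<inter> C) x" if "C \<subseteq> I" for C
    by (rule coord_exp_coord_exp[OF A that P.integrable_if_square_integrable[OF f]])
  have "AE x in ?P. coord_exp A ?d x = coord_exp A (?e (A \<union> B)) x - coord_exp A (?e B) x"
    using A B f
    by (intro A.real_cond_exp_diff P.integrable_if_square_integrable
        square_integrable_coord_exp) auto
  moreover have "AE x in ?P. coord_exp A (?e (A \<union> B)) x = ?e A x"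
    using project[of "A \<union> B"] A B by (simp add: Int_absorb2)
  ultimately have "AE x in ?P. coord_exp A ?d x = ?e A x - ?e (A \<inter> B) x"
    using project[OF B] by eventually_elim simp
  then have "?v A - ?v (A \<inter> B) = (\<integral>x. (coord_exp A ?d x)\<^sup>2 \<partial>?P)"
    using A f by (subst coord_variance_increment) (auto intro!: integral_cong_AE)
  also have "\<dots> \<le> (\<integral>x. (?d x)\<^sup>2 \<partial>?P)"
    using A B f
    by (intro A.integral_real_cond_exp_square_le square_integrable_diff
        square_integrable_coord_exp) auto
  also have "\<dots> = ?v (A \<union> B) - ?v B"
    using A B f by (intro coord_variance_increment[symmetric]) auto
  finally show "?v A + ?v B \<le> ?v (A \<union> B) + ?v (A \<inter> B)"
    by simp
qed

lemma coord_variance_empty: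
  assumes "integrable (PiM I M) f"
  shows "coord_variance f {} = 0"
proof -
  let ?e = "coord_exp {} f"
  obtain w where w: "w \<in> space (PiM I M)"
    using P.not_empty by blast
  have "?e x = ?e w" if "x \<in> space (PiM I M)" for x
    using that w by (intro borel_measurable_cylinder_algebraD[OF _ borel_measurable_cond_exp]) auto
  then have "P.variance ?e = P.variance (\<lambda>_. ?e w)"
    by (intro P.variance_cong_AE) (auto intro!: AE_I2)
  then show ?thesis
    by (simp add: explained_variance_def P.prob_space)
qed

lemma coord_variance_full:
  assumes f: "integrable (PiM I M) f"
  shows "coord_variance f I = P.variance f"
proof -
  interpret finite_measure_subalgebra "PiM I M" "cylinder_algebra I M I"
    by (rule finite_measure_subalgebra_cylinder_algebra[OF order_refl])
  have "f \<in> borel_measurable (cylinder_algebra I M I)"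
    using f by (intro borel_measurable_cylinder_algebraI) (auto simp: space_PiM)
  then show ?thesis
    unfolding explained_variance_def using f by (intro P.variance_cong_AE real_cond_exp_F_meas) auto
qed

lemma sum_coord_variance_le:
  assumes f: "square_integrable (PiM I M) f" and J: "finite J"
    and S: "\<And>j. j \<in> J \<Longrightarrow> S j \<subseteq> I"
    and cover: "\<And>i. i \<in> I \<Longrightarrow> real (card {j \<in> J. i \<in> S j}) \<le> c"
  shows "(\<Sum>j\<in>J. coord_variance f (S j)) \<le> c * P.variance f"
proof -
  have "(\<Sum>j\<in>J. coord_variance f (S j)) \<le> c * coord_variance f I"
    using S cover
    by (intro sum_supermodular_le finite_index J supermodular_on_coord_variance
        mono_on_coord_variance coord_variance_empty P.integrable_if_square_integrable f)
  then show ?thesis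
    by (simp add: coord_variance_full[OF P.integrable_if_square_integrable[OF f]])
qed

end

section \<open>Permuting the coordinates\<close>

lemma coord_algebra_eq_cylinder_algebra:
  assumes "U \<subseteq> V"
  shows "coord_algebra V M U = cylinder_algebra V (\<lambda>_. M) U"
proof -
  let ?\<Omega> = "space (iid_space V M)" and ?S = "space (iid_space U M)" and ?r = "\<lambda>x. restrict x U"
  let ?R = "{{x \<in> ?S. x u \<in> B} | u B. u \<in> U \<and> B \<in> sets M}"
  have preimage: "?r -` {x \<in> ?S. x u \<in> B} \<inter> ?\<Omega> = (\<lambda>x. x u) -` B \<inter> ?\<Omega>"
    if "u \<in> U" for u B
    using that assms by (auto simp: space_PiM)
  have "sets (iid_space U M) = sets (sigma ?S ?R)"
    by (subst sets_PiM_single) (auto simp: space_PiM intro!: sets_measure_of[symmetric])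
  then have "cylinder_algebra V (\<lambda>_. M) U = vimage_algebra ?\<Omega> ?r (sigma ?S ?R)"
    unfolding cylinder_algebra_def by (intro vimage_algebra_cong refl)
  also have "\<dots> = sigma ?\<Omega> {?r -` A \<inter> ?\<Omega> | A. A \<in> ?R}"
    using assms by (intro vimage_algebra_sigma) (auto simp: space_PiM)
  also have "{?r -` A \<inter> ?\<Omega> | A. A \<in> ?R}
      = {?r -` {x \<in> ?S. x u \<in> B} \<inter> ?\<Omega> | u B. u \<in> U \<and> B \<in> sets M}"
    by blast
  also have "\<dots> = {(\<lambda>x. x u) -` B \<inter> ?\<Omega> | u B. u \<in> U \<and> B \<in> sets M}"
    by (simp only: preimage cong: rev_conj_cong)
  finally show ?thesis
    by (simp add: coord_algebra_def)
qed

lemma measurable_permute_coords: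
  assumes "bij_betw \<gamma> V V"
  shows "permute_coords V \<gamma> \<in> measurable (iid_space V M) (iid_space V M)"
proof -
  have "inv_into V \<gamma> v \<in> V" if "v \<in> V" for v
    using bij_betw_inv_into[OF assms] that by (auto simp: bij_betw_def)
  then show ?thesis
    unfolding permute_coords_def[abs_def] by (intro measurable_restrict) auto
qed

lemma distr_permute_coords:
  assumes "prob_space M" "bij_betw \<gamma> V V"
  shows "distr (iid_space V M) (iid_space V M) (permute_coords V \<gamma>) = iid_space V M"
  unfolding permute_coords_def[abs_def] using assms bij_betw_inv_into[OF assms(2)]
  by (intro distr_PiM_reindex) (auto simp: bij_betw_def)

lemma vimage_algebra_permute_coords:
  assumes \<gamma>: "bij_betw \<gamma> V V" and U: "U \<subseteq> V"
  shows "vimage_algebra (space (iid_space V M)) (permute_coords V \<gamma>) (coord_algebra V M (\<gamma> ` U))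
    = coord_algebra V M U"
proof -
  let ?\<Omega> = "space (iid_space V M)" and ?T = "permute_coords V \<gamma>"
  let ?G = "\<lambda>U. {(\<lambda>x. x u) -` B \<inter> ?\<Omega> | u B. u \<in> U \<and> B \<in> sets M}"
  have T: "?T x \<in> ?\<Omega>" if "x \<in> ?\<Omega>" for x
    using that by (rule measurable_space[OF measurable_permute_coords[OF \<gamma>]])
  have preimage: "?T -` ((\<lambda>x. x (\<gamma> u)) -` B \<inter> ?\<Omega>) \<inter> ?\<Omega> = (\<lambda>x. x u) -` B \<inter> ?\<Omega>" if "u \<in> U" for u B
  proof -
    have "?T x (\<gamma> u) = x u" for x
      using that \<gamma> U by (auto simp: permute_coords_def bij_betw_def inv_into_f_f subset_iff)
    then show ?thesis
      using T by auto
  qed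
  have "vimage_algebra ?\<Omega> ?T (sigma ?\<Omega> (?G (\<gamma> ` U))) = sigma ?\<Omega> {?T -` A \<inter> ?\<Omega> | A. A \<in> ?G (\<gamma> ` U)}"
    using T by (intro vimage_algebra_sigma) auto
  also have "{?T -` A \<inter> ?\<Omega> | A. A \<in> ?G (\<gamma> ` U)}
      = {?T -` ((\<lambda>x. x (\<gamma> u)) -` B \<inter> ?\<Omega>) \<inter> ?\<Omega> | u B. u \<in> U \<and> B \<in> sets M}"
    by blast
  also have "\<dots> = ?G U"
    by (simp only: preimage cong: rev_conj_cong)
  finally show ?thesis
    by (simp add: coord_algebra_def)
qed

lemma explained_variance_permute_coords:
  assumes M: "prob_space M" and \<gamma>: "bij_betw \<gamma> V V" and U: "U \<subseteq> V"
    and f: "integrable (iid_space V M) f"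
    and inv: "AE x in iid_space V M. f (permute_coords V \<gamma> x) = f x"
  shows "explained_variance (iid_space V M) (coord_algebra V M (\<gamma> ` U)) f
    = explained_variance (iid_space V M) (coord_algebra V M U) f"
proof -
  interpret prob_space "iid_space V M"
    by (rule prob_space_PiM[OF M])
  have sub: "subalgebra (iid_space V M) (coord_algebra V M W)" if "W \<subseteq> V" for W
    using that by (simp add: coord_algebra_eq_cylinder_algebra subalgebra_cylinder_algebra)
  have \<gamma>U: "\<gamma> ` U \<subseteq> V"
    using \<gamma> U by (auto simp: bij_betw_def)
  have "explained_variance (iid_space V M) (coord_algebra V M (\<gamma> ` U)) f
      = explained_variance (iid_space V M) (coord_algebra V M U) (\<lambda>x. f (permute_coords V \<gamma> x))"
    using explained_variance_vimage_algebra
      [OF measurable_permute_coords[OF \<gamma>] distr_permute_coords[OF M \<gamma>] sub[OF \<gamma>U] f]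
    by (simp add: vimage_algebra_permute_coords[OF \<gamma> U])
  also have "\<dots> = explained_variance (iid_space V M) (coord_algebra V M U) f"
    using f measurable_compose[OF measurable_permute_coords[OF \<gamma>] borel_measurable_integrable[OF f]]
    by (intro explained_variance_cong_AE sub U inv) auto
  finally show ?thesis .
qed

section \<open>The clue of a transitive function\<close>

lemma clue_eq_explained_variance:
  "clue V M f U =
    explained_variance (iid_space V M) (coord_algebra V M U) f
      / prob_space.variance (iid_space V M) f"
  by (simp add: clue_def explained_variance_def)

lemma sum_clue_le:
  assumes "finite V" "prob_space M" and f: "square_integrable (iid_space V M) f"
    and var: "prob_space.variance (iid_space V M) f > 0" and "finite J"
    and S: "\<And>j. j \<in> J \<Longrightarrow> S j \<subseteq> V"
    and cover: "\<And>v. v \<in> V \<Longrightarrow> real (card {j \<in> J. v \<in> S j}) \<le> c"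
  shows "(\<Sum>j\<in>J. clue V M f (S j)) \<le> c"
proof -
  interpret M: prob_space M
    by fact
  interpret finite_product_prob_space "\<lambda>_. M" V
    by unfold_locales fact
  have "(\<Sum>j\<in>J. explained_variance (iid_space V M) (coord_algebra V M (S j)) f) \<le> c * P.variance f"
    using sum_coord_variance_le[OF f \<open>finite J\<close> S cover] S
    by (simp add: coord_algebra_eq_cylinder_algebra)
  then show ?thesis
    using var by (simp add: clue_eq_explained_variance divide_le_eq flip: sum_divide_distrib)
qed

lemma variance_iid_space_empty:
  "prob_space.variance (iid_space {} M) (f :: _ \<Rightarrow> real) = 0"
  by (simp add: PiM_empty lebesgue_integral_count_space_finite)

lemma clue_le:
  assumes "finite V" and M: "prob_space M"
    and f: "square_integrable (iid_space V M) f"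
    and var: "prob_space.variance (iid_space V M) f > 0"
    and \<Gamma>: "transitive_perm_group V \<Gamma>" and inv: "perm_invariant V M \<Gamma> f"
    and U: "U \<subseteq> V"
  shows "clue V M f U \<le> real (card U) / real (card V)"
proof -
  interpret transitive_action "(BijGroup V)\<lparr>carrier := \<Gamma>\<rparr>" V "\<lambda>\<gamma>. \<gamma>"
    using \<Gamma> by (simp add: transitive_perm_group_def)
  interpret prob_space "iid_space V M"
    by (rule prob_space_PiM[OF M])
  obtain v where v: "v \<in> V"
    using var variance_iid_space_empty[of M f] by (cases "V = {}") auto
  have bij: "bij_betw \<gamma> V V" if "\<gamma> \<in> \<Gamma>" for \<gamma>
    using bij_prop0[of \<gamma>] that by (simp add: Bij_def)
  have clue_translate: "clue V M f (\<gamma> ` U) = clue V M f U" if "\<gamma> \<in> \<Gamma>" for \<gamma>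
    using inv that unfolding clue_eq_explained_variance perm_invariant_def
    by (subst explained_variance_permute_coords[OF M bij U])
      (auto intro: integrable_if_square_integrable f)
  have translate: "\<gamma> ` U \<subseteq> V" if "\<gamma> \<in> \<Gamma>" for \<gamma>
    using element_image[of \<gamma>] that U by auto
  have fin: "finite \<Gamma>"
    using bij_prop0 finite_subset[OF _ finite_Bij[OF \<open>finite V\<close>]] by auto
  have pos: "0 < card \<Gamma>" "0 < card V"
    using unique_orbit[OF v v] fin v \<open>finite V\<close> by (auto simp: card_gt_0_iff)
  have count: "real (card {\<gamma> \<in> \<Gamma>. w \<in> \<gamma> ` U}) = real (card \<Gamma>) * (real (card U) / real (card V))"
    if "w \<in> V" for w
    using arg_cong[OF card_translates_containing[OF _ \<open>finite V\<close> U that], of real] fin pos(2)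
    by (simp add: order_def field_simps)
  have "real (card \<Gamma>) * clue V M f U = (\<Sum>\<gamma>\<in>\<Gamma>. clue V M f (\<gamma> ` U))"
    by (simp add: clue_translate)
  also have "\<dots> \<le> real (card \<Gamma>) * (real (card U) / real (card V))"
    by (intro sum_clue_le \<open>finite V\<close> M f var fin translate) (simp_all add: count)
  finally show ?thesis
    using pos by (simp only: mult_le_cancel_left_pos of_nat_0_less_iff)
qed

lemma not_sparse_reconstruction:
  assumes fin: "\<And>n. finite (V n)" and prob: "\<And>n. prob_space (M n)"
    and f: "\<And>n. square_integrable (iid_space (V n) (M n)) (f n)"
    and var: "\<And>n. prob_space.variance (iid_space (V n) (M n)) (f n) > 0"
    and inv: "\<And>n. \<exists>\<Gamma>. transitive_perm_group (V n) \<Gamma> \<and> perm_invariant (V n) (M n) \<Gamma> (f n)"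
  shows "\<not> sparse_reconstruction V M f"
proof
  assume "sparse_reconstruction V M f"
  then obtain U where U: "\<And>n. U n \<subseteq> V n"
    and lim: "(\<lambda>n. real (card (U n)) / real (card (V n))) \<longlonglongrightarrow> 0"
    and liminf: "liminf (\<lambda>n. ereal (clue (V n) (M n) (f n) (U n))) > 0"
    unfolding sparse_reconstruction_def by blast
  have "clue (V n) (M n) (f n) (U n) \<le> real (card (U n)) / real (card (V n))" for n
    using inv[of n] clue_le[OF fin prob f var _ _ U] by blast
  then have "liminf (\<lambda>n. ereal (clue (V n) (M n) (f n) (U n)))
      \<le> liminf (\<lambda>n. ereal (real (card (U n)) / real (card (V n))))"
    by (intro Liminf_mono always_eventually) simp
  also have "\<dots> = 0"
    using lim_imp_Liminf[OF sequentially_bot tendsto_ereal[OF lim]] by (simp add: zero_ereal_def)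
  finally show False
    using liminf by simp
qed

theorem theorem1p1:
  shows "(\<forall>(V :: 'v set) (M :: 'a measure) (f :: ('v \<Rightarrow> 'a) \<Rightarrow> real) \<Gamma>.
            finite V \<longrightarrow> V \<noteq> {} \<longrightarrow> prob_space M \<longrightarrow>
            square_integrable (iid_space V M) f \<longrightarrow>
            prob_space.variance (iid_space V M) f > 0 \<longrightarrow>
            transitive_perm_group V \<Gamma> \<longrightarrow> perm_invariant V M \<Gamma> f \<longrightarrow>
            (\<forall>U. U \<subseteq> V \<longrightarrow> clue V M f U \<le> real (card U) / real (card V)))
       \<and> (\<forall>(V :: nat \<Rightarrow> 'w set) (M :: nat \<Rightarrow> 'b measure) (f :: nat \<Rightarrow> ('w \<Rightarrow> 'b) \<Rightarrow> real).
            (\<forall>n. finite (V n) \<and> prob_space (M n) \<and>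
                 square_integrable (iid_space (V n) (M n)) (f n) \<and>
                 prob_space.variance (iid_space (V n) (M n)) (f n) > 0 \<and>
                 (\<exists>\<Gamma>. transitive_perm_group (V n) \<Gamma> \<and> perm_invariant (V n) (M n) \<Gamma> (f n)))
            \<longrightarrow> \<not> sparse_reconstruction V M f)"
proof (intro conjI allI impI)
  show "clue V M f U \<le> real (card U) / real (card V)"
    if "finite V" "V \<noteq> {}" "prob_space M" "square_integrable (iid_space V M) f"
      "prob_space.variance (iid_space V M) f > 0" "transitive_perm_group V \<Gamma>"
      "perm_invariant V M \<Gamma> f" "U \<subseteq> V"
    for V :: "'v set" and M :: "'a measure" and f :: "('v \<Rightarrow> 'a) \<Rightarrow> real" and \<Gamma> U
    using that(1,3-) by (rule clue_le)
qed (rule not_sparse_reconstruction, blast+)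

end
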